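(* Let $\rho$ be an admissible weight function on $\mathbb{R}$ with $\sup_{k\in\mathbb{Z}}\frac{\rho(k+1)}{\rho(k)}<\infty$, and let $\mathcal{T}=(T_t)_{t\ge0}$ be the translation semigroup on $C_0^\rho(\mathbb{R})$. Then $\mathcal{T}$ is frequently hypercyclic on $C_0^\rho(\mathbb{R})$ if and only if there exist a sequence $(M(p))_{p\in\mathbb{N}}$ of positive real numbers tending to $\infty$ and a sequence $(E_p)_{p\in\mathbb{N}}$ of subsets of $\mathbb{N}$ such that: (a) for any $p\ge1$, $\underline{\mathrm{dens}}(E_p)>0$; (b) for any distinct $p,q\ge1$, $(E_p+([-p,p]\cap\mathbb{Z}))\cap(E_q+([-q,q]\cap\mathbb{Z}))=\emptyset$; (c) for any $p\ge1$, $\lim_{n\to\infty,\,n\in E_p}\rho(n)=0$; (d) for any $p,q\ge1$ and any $n\in E_p$ and $m\in E_q$ with $m\ne n$, $$\rho(m-n)\le\frac{1}{M(p)M(q)}.$$ Moreover, the same equivalence holds with "there exist a sequence $(M(p))_{p\in\mathbb{N}}$ and a sequence $(E_p)_{p\in\mathbb{N}}$" replaced by "for any sequence $(M(p))_{p\in\mathbb{N}}$ (of positive real numbers tending to $\infty$) there exists a sequence $(E_p)_{p\in\mathbb{N}}$".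
   Context: $\mathbb{N}=\{1,2,\dots\}$. An admissible weight function on $\mathbb{R}$ is a measurable function $\rho:\mathbb{R}\to\,]0,\infty[$ for which there exist $M\ge1$ and $\omega\in\mathbb{R}$ such that $\rho(\tau)\le Me^{\omega t}\rho(\tau+t)$ for all $\tau\in\mathbb{R}$ and $t>0$. $C_0^\rho(\mathbb{R})$ is the space of continuous $u:\mathbb{R}\to\mathbb{R}$ with $\lim_{x\to\pm\infty}u(x)\rho(x)=0$, with norm $\|u\|_\infty^\rho=\sup_{t\in\mathbb{R}}|u(t)|\rho(t)$. The translation semigroup on it is $T_tf(x)=f(x+t)$, $t\ge0$, $x\in\mathbb{R}$; it is a $C_0$-semigroup. The lower density of $A\subseteq\mathbb{N}$ is $\underline{\mathrm{dens}}(A)=\liminf_{N\to\infty}\#\{n\le N:n\in A\}/N$. The lower density of a measurable set $S\subseteq\mathbb{R}_+$ is $\underline{\mathrm{Dens}}(S)=\liminf_{N\to\infty}\mu(S\cap[0,N])/N$, with $\mu$ Lebesgue measure. A $C_0$-semigroup $(T_t)_{t\ge0}$ on a separable Banach space $X$ is frequently hypercyclic if there exists $x\in X$ such that $\underline{\mathrm{Dens}}(\{t\in\mathbb{R}_+:T_tx\in U\})>0$ for every non-empty open $U\subseteq X$. *)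

theory Defs
  imports "HOL-Analysis.Analysis"
begin

(* The natural numbers of the mathematics start at 1; sets of such numbers are
   nat sets contained in {1..}. *)

text \<open>Admissible weights; measurability is with respect to Lebesgue measurable sets.\<close>

definition admissible_weight :: "(real \<Rightarrow> real) \<Rightarrow> bool" where
  "admissible_weight \<rho> \<longleftrightarrow>
     \<rho> \<in> borel_measurable lebesgue \<and> (\<forall>x. 0 < \<rho> x) \<and>
     (\<exists>M \<omega>. 1 \<le> M \<and> (\<forall>\<tau> t. 0 < t \<longrightarrow> \<rho> \<tau> \<le> M * exp (\<omega> * t) * \<rho> (\<tau> + t)))"

definition C0w :: "(real \<Rightarrow> real) \<Rightarrow> (real \<Rightarrow> real) set" where
  "C0w \<rho> = {u. continuous_on UNIV u \<and>
                ((\<lambda>x. u x * \<rho> x) \<longlongrightarrow> 0) at_top \<and> ((\<lambda>x. u x * \<rho> x) \<longlongrightarrow> 0) at_bot}"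

definition C0w_norm :: "(real \<Rightarrow> real) \<Rightarrow> (real \<Rightarrow> real) \<Rightarrow> real" where
  "C0w_norm \<rho> u = (SUP t. \<bar>u t\<bar> * \<rho> t)"

text \<open>The norm distance. The value outside of \<open>C0w \<rho>\<close> is irrelevant; it is set to 0 because
  the locale \<open>Metric_space\<close> asks for a nonnegative distance on the whole type, and the
  supremum may be a junk value there.\<close>

definition C0w_dist :: "(real \<Rightarrow> real) \<Rightarrow> (real \<Rightarrow> real) \<Rightarrow> (real \<Rightarrow> real) \<Rightarrow> real" where
  "C0w_dist \<rho> u v =
     (if u \<in> C0w \<rho> \<and> v \<in> C0w \<rho> then C0w_norm \<rho> (\<lambda>x. u x - v x) else 0)"

definition C0w_topology :: "(real \<Rightarrow> real) \<Rightarrow> (real \<Rightarrow> real) topology" where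
  "C0w_topology \<rho> = Metric_space.mtopology (C0w \<rho>) (C0w_dist \<rho>)"

definition translation :: "real \<Rightarrow> (real \<Rightarrow> real) \<Rightarrow> real \<Rightarrow> real" where
  "translation t f = (\<lambda>x. f (x + t))"

definition lower_dens :: "nat set \<Rightarrow> ereal" where
  "lower_dens A = liminf (\<lambda>N. ereal (real (card (A \<inter> {1..N})) / real N))"

definition lower_Dens :: "real set \<Rightarrow> ereal" where
  "lower_Dens S = liminf (\<lambda>N. ereal (measure lebesgue (S \<inter> {0..real N}) / real N))"

text \<open>Frequent hypercyclicity of a one-parameter family \<open>(T t)\<close>, \<open>t \<ge> 0\<close>, on the
  space with topology \<open>X\<close>. It refers to the Banach space only through its topology.\<close>

definition frequently_hypercyclic :: "'a topology \<Rightarrow> (real \<Rightarrow> 'a \<Rightarrow> 'a) \<Rightarrow> bool" where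
  "frequently_hypercyclic X T \<longleftrightarrow>
     (\<exists>x \<in> topspace X. \<forall>U. openin X U \<and> U \<noteq> {} \<longrightarrow> 0 < lower_Dens {t. 0 \<le> t \<and> T t x \<in> U})"

text \<open>Sequences indexed by \<open>p \<ge> 1\<close>; the values at 0 are irrelevant.\<close>

definition pos_seq_to_infinity :: "(nat \<Rightarrow> real) \<Rightarrow> bool" where
  "pos_seq_to_infinity M \<longleftrightarrow> (\<forall>p\<ge>1. 0 < M p) \<and> filterlim M at_top sequentially"

text \<open>The sum of sets of integers is the Minkowski sum, taken in the integers because
  \<open>n - p\<close> may be negative.\<close>

definition fhc_sets :: "(real \<Rightarrow> real) \<Rightarrow> (nat \<Rightarrow> real) \<Rightarrow> (nat \<Rightarrow> nat set) \<Rightarrow> bool" where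
  "fhc_sets \<rho> M E \<longleftrightarrow>
     (\<forall>p\<ge>1. E p \<subseteq> {1..}) \<and>
     (\<forall>p\<ge>1. 0 < lower_dens (E p)) \<and>
     (\<forall>p\<ge>1. \<forall>q\<ge>1. p \<noteq> q \<longrightarrow>
        (int ` E p + {- int p..int p}) \<inter> (int ` E q + {- int q..int q}) = {}) \<and>
     (\<forall>p\<ge>1. ((\<lambda>n. \<rho> (real n)) \<longlongrightarrow> 0) (inf sequentially (principal (E p)))) \<and>
     (\<forall>p\<ge>1. \<forall>q\<ge>1. \<forall>n\<in>E p. \<forall>m\<in>E q. m \<noteq> n \<longrightarrow>
        \<rho> (real m - real n) \<le> 1 / (M p * M q))"

lemma C0w_bdd_above:
  assumes \<rho>: "admissible_weight \<rho>" and u: "u \<in> C0w \<rho>"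
  shows "bdd_above (range (\<lambda>t. \<bar>u t\<bar> * \<rho> t))"
proof -
  have pos: "\<And>x. 0 < \<rho> x"
    using \<rho> by (auto simp: admissible_weight_def)
  obtain M \<omega> where M: "1 \<le> M"
    and le: "\<And>\<tau> t. 0 < t \<Longrightarrow> \<rho> \<tau> \<le> M * exp (\<omega> * t) * \<rho> (\<tau> + t)"
    using \<rho> by (auto simp: admissible_weight_def)
  have "\<forall>\<^sub>F x in at_top. \<bar>u x * \<rho> x\<bar> < 1" "\<forall>\<^sub>F x in at_bot. \<bar>u x * \<rho> x\<bar> < 1"
    using u tendstoD[of "\<lambda>x. u x * \<rho> x" 0 _ 1] by (auto simp: C0w_def)
  then obtain b a where ab: "\<And>x. b \<le> x \<Longrightarrow> \<bar>u x * \<rho> x\<bar> < 1" "\<And>x. x \<le> a \<Longrightarrow> \<bar>u x * \<rho> x\<bar> < 1"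
    unfolding eventually_at_top_linorder eventually_at_bot_linorder by blast
  have "compact (u ` {a..b})"
    using u by (intro compact_continuous_image) (auto simp: C0w_def intro: continuous_on_subset)
  then obtain K where K: "\<And>x. x \<in> {a..b} \<Longrightarrow> \<bar>u x\<bar> \<le> K"
    by (force dest: compact_imp_bounded simp: bounded_iff)
  define L where "L = M * exp (\<bar>\<omega>\<bar> * (b - a + 1)) * \<rho> (b + 1)"
  have L: "\<rho> x \<le> L" if "x \<in> {a..b}" for x
  proof -
    have "\<rho> x \<le> M * exp (\<omega> * (b + 1 - x)) * \<rho> (b + 1)"
      using le[of "b + 1 - x" x] that by simp
    moreover have "\<omega> * (b + 1 - x) \<le> \<bar>\<omega>\<bar> * (b - a + 1)"
      using that by (intro mult_mono) auto
    ultimately show ?thesis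
      using M pos[of "b + 1"] unfolding L_def
      by (smt (verit) exp_le_cancel_iff mult_left_mono mult_right_mono)
  qed
  have "\<bar>u x\<bar> * \<rho> x \<le> max 1 (K * L)" for x
  proof (cases "x \<in> {a..b}")
    case True
    then have "\<bar>u x\<bar> * \<rho> x \<le> K * L"
      using K[OF True] L[OF True] pos[of x] by (intro mult_mono) (auto intro: order_trans[OF abs_ge_zero])
    then show ?thesis by simp
  next
    case False
    then have "\<bar>u x * \<rho> x\<bar> < 1"
      using ab by (meson atLeastAtMost_iff linear)
    then show ?thesis
      using pos[of x] by (simp add: abs_mult)
  qed
  then show ?thesis by (rule bdd_aboveI2)
qed

lemma C0w_diff: "u \<in> C0w \<rho> \<Longrightarrow> v \<in> C0w \<rho> \<Longrightarrow> (\<lambda>x. u x - v x) \<in> C0w \<rho>"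
  unfolding C0w_def
  by (auto intro!: continuous_intros simp: left_diff_distrib intro: tendsto_diff[where a=0 and b=0, simplified])

lemma Metric_space_C0w:
  assumes \<rho>: "admissible_weight \<rho>"
  shows "Metric_space (C0w \<rho>) (C0w_dist \<rho>)"
proof -
  have pos: "\<And>x. 0 < \<rho> x"
    using \<rho> by (auto simp: admissible_weight_def)
  have up: "\<bar>u t - v t\<bar> * \<rho> t \<le> C0w_dist \<rho> u v" if "u \<in> C0w \<rho>" "v \<in> C0w \<rho>" for u v t
    using C0w_bdd_above[OF \<rho> C0w_diff[OF that]] that
    by (auto simp: C0w_dist_def C0w_norm_def intro: cSUP_upper)
  have nonneg: "0 \<le> C0w_dist \<rho> u v" for u v
  proof (cases "u \<in> C0w \<rho> \<and> v \<in> C0w \<rho>")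
    case True
    have "0 \<le> \<bar>u 0 - v 0\<bar> * \<rho> 0"
      using pos[of 0] by simp
    then show ?thesis
      using up[of u v 0] True by linarith
  qed (auto simp: C0w_dist_def)
  show ?thesis
  proof
    show "C0w_dist \<rho> u v = C0w_dist \<rho> v u" for u v
      by (simp add: C0w_dist_def C0w_norm_def abs_minus_commute)
    show "C0w_dist \<rho> u v = 0 \<longleftrightarrow> u = v" if "u \<in> C0w \<rho>" "v \<in> C0w \<rho>" for u v
    proof
      assume "C0w_dist \<rho> u v = 0"
      then have "\<bar>u t - v t\<bar> * \<rho> t \<le> 0" for t
        using up[OF that, of t] by simp
      then have "u t = v t" for t
        using pos[of t] by (metis abs_ge_zero abs_le_zero_iff eq_iff_diff_eq_0 mult_pos_pos not_less order_le_less)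
      then show "u = v" by auto
    qed (simp add: C0w_dist_def C0w_norm_def)
    show "C0w_dist \<rho> u w \<le> C0w_dist \<rho> u v + C0w_dist \<rho> v w"
      if "u \<in> C0w \<rho>" "v \<in> C0w \<rho>" "w \<in> C0w \<rho>" for u v w
    proof -
      have "\<bar>u t - w t\<bar> * \<rho> t \<le> C0w_dist \<rho> u v + C0w_dist \<rho> v w" for t
      proof -
        have "\<bar>u t - w t\<bar> * \<rho> t \<le> (\<bar>u t - v t\<bar> + \<bar>v t - w t\<bar>) * \<rho> t"
          using pos[of t] by (intro mult_right_mono) auto
        then show ?thesis
          using up[OF that(1,2), of t] up[OF that(2,3), of t] by (simp add: distrib_right)
      qed
      then have "C0w_norm \<rho> (\<lambda>x. u x - w x) \<le> C0w_dist \<rho> u v + C0w_dist \<rho> v w"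
        unfolding C0w_norm_def by (intro cSUP_least) auto
      then show ?thesis
        using that by (simp add: C0w_dist_def)
    qed
  qed (rule nonneg)
qed

lemma topspace_C0w: "admissible_weight \<rho> \<Longrightarrow> topspace (C0w_topology \<rho>) = C0w \<rho>"
  unfolding C0w_topology_def
  by (intro Metric_space.topspace_mtopology Metric_space_C0w)

end

theory Submission
  imports Defs
begin

text \<open>Under the hypotheses, \<open>\<rho> x\<close> and \<open>\<rho> y\<close> are comparable within a factor \<open>K ^ n\<close> whenever
  \<open>\<bar>x - y\<bar> \<le> n\<close>, so that continuous and integer times are interchangeable.

  If \<open>f\<close> is a frequently hypercyclic vector, let \<open>A p\<close> be the set of times at which the orbit of \<open>f\<close> is
  \<open>\<epsilon> p\<close>-close to a tent of height \<open>H p\<close> supported in \<open>{- 1..1}\<close>. With \<open>H p > M p\<close>, heights at least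
  2 apart and \<open>\<epsilon> p\<close> small, a time \<open>t \<in> A p\<close> and a distant time \<open>s \<in> A q\<close> satisfy
  \<open>M q * \<rho> (s - t) \<le> \<bar>f s\<bar> * \<rho> (s - t) < \<epsilon> p\<close>, which is (d); close times are excluded for
  \<open>p \<noteq> q\<close> by the different heights. Rounding the times gives the sets \<open>E p\<close>.

  Conversely, take a dense sequence \<open>G k\<close> of compactly supported functions and a subsequence \<open>p k\<close>
  along which \<open>M\<close> grows fast compared with \<open>G k\<close>, and place a copy of \<open>G k\<close> at every far enough
  \<open>n \<in> E (p k)\<close>. By (b) and (d) the copies are disjoint, by (c) the resulting function lies in the space,
  and by (d) its translate by \<open>n\<close> is close to \<open>G k\<close>.\<close>

section \<open>Positivity of lower densities\<close>

text \<open>Turns positivity of a lower density into an eventual linear lower bound, in which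
  bounded errors cost only part of the slope \<open>c\<close>.\<close>

lemma liminf_ratio_pos_iff:
  fixes a :: "nat \<Rightarrow> real"
  shows "0 < liminf (\<lambda>N. ereal (a N / real N)) \<longleftrightarrow> (\<exists>c>0. \<forall>\<^sub>F N in sequentially. c * real N \<le> a N)"
proof
  assume "0 < liminf (\<lambda>N. ereal (a N / real N))"
  then obtain c where c: "0 < c" "ereal c < liminf (\<lambda>N. ereal (a N / real N))"
    using ereal_dense2 by (metis ereal_less(2) zero_ereal_def)
  then have "\<forall>\<^sub>F N in sequentially. ereal c < ereal (a N / real N)"
    by (intro less_LiminfD)
  then have "\<forall>\<^sub>F N in sequentially. c * real N \<le> a N"
    using eventually_gt_at_top[of 0] by eventually_elim (simp add: field_simps)
  with c show "\<exists>c>0. \<forall>\<^sub>F N in sequentially. c * real N \<le> a N" by blast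
next
  assume "\<exists>c>0. \<forall>\<^sub>F N in sequentially. c * real N \<le> a N"
  then obtain c where c: "c > 0" "\<forall>\<^sub>F N in sequentially. c * real N \<le> a N" by blast
  from c(2) have "\<forall>\<^sub>F N in sequentially. ereal c \<le> ereal (a N / real N)"
    using eventually_gt_at_top[of 0] by eventually_elim (simp add: field_simps)
  then have "ereal c \<le> liminf (\<lambda>N. ereal (a N / real N))"
    by (rule Liminf_bounded)
  with c(1) show "0 < liminf (\<lambda>N. ereal (a N / real N))"
    by (metis ereal_less(2) less_le_trans)
qed

lemmas lower_dens_pos_iff =
  liminf_ratio_pos_iff[of "\<lambda>N. real (card (A \<inter> {1..N}))" for A, folded lower_dens_def]

lemmas lower_Dens_pos_iff =
  liminf_ratio_pos_iff[of "\<lambda>N. measure lebesgue (S \<inter> {0..real N})" for S, folded lower_Dens_def]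

lemma lower_dens_pos_tail:
  assumes "0 < lower_dens A"
  shows "0 < lower_dens (A \<inter> {b..})"
proof -
  obtain c where c: "c > 0" "\<forall>\<^sub>F N in sequentially. c * real N \<le> real (card (A \<inter> {1..N}))"
    using assms lower_dens_pos_iff by blast
  \<comment> \<open>From \<open>N0\<close> on, half of \<open>c * real N\<close> pays for the at
    most \<open>b\<close> deleted elements.\<close>
  obtain N0 :: nat where N0: "real b \<le> c / 2 * real N0"
    using c(1) by (metis half_gt_zero mult.commute reals_Archimedean3 less_imp_le)
  have "\<forall>\<^sub>F N in sequentially. c / 2 * real N \<le> real (card ((A \<inter> {b..}) \<inter> {1..N}))"
    using c(2) eventually_ge_at_top[of N0]
  proof eventually_elim
    case (elim N)
    have "A \<inter> {1..N} \<subseteq> ((A \<inter> {b..}) \<inter> {1..N}) \<union> {..<b}" by auto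
    then have "card (A \<inter> {1..N}) \<le> card (((A \<inter> {b..}) \<inter> {1..N}) \<union> {..<b})"
      by (intro card_mono) auto
    also have "\<dots> \<le> card ((A \<inter> {b..}) \<inter> {1..N}) + b"
      using card_Un_le[of "(A \<inter> {b..}) \<inter> {1..N}" "{..<b}"] by simp
    finally have "real (card (A \<inter> {1..N})) \<le> real (card ((A \<inter> {b..}) \<inter> {1..N})) + real b"
      by (metis of_nat_add of_nat_mono)
    moreover have "c / 2 * real N0 \<le> c / 2 * real N"
      using c(1) elim by (intro mult_left_mono) auto
    ultimately show ?case using elim N0 by argo
  qed
  with c(1) show ?thesis
    unfolding lower_dens_pos_iff by (intro exI[of _ "c / 2"]) auto
qed

section \<open>Weights comparable at unit distance, and the space \<open>C0w \<rho>\<close>\<close>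

locale comparable_weight =
  fixes \<rho> :: "real \<Rightarrow> real" and K :: real
  assumes adm: "admissible_weight \<rho>"
    and K_ge_1: "1 \<le> K"
    and unit_comparable: "\<bar>x - y\<bar> \<le> 1 \<Longrightarrow> \<rho> x \<le> K * \<rho> y"

text \<open>Admissibility bounds \<open>\<rho> x\<close> by values to the right of \<open>x\<close>.
  For \<open>y\<close> on the left, the bound goes up from \<open>x\<close> to the integer
  \<open>\<lfloor>y\<rfloor> + 2\<close>, down two integers by the ratio hypothesis, and up from
  \<open>\<lfloor>y\<rfloor>\<close> to \<open>y\<close>.\<close>

lemma admissible_imp_comparable_weight:
  assumes adm: "admissible_weight \<rho>"
    and bdd: "bdd_above (range (\<lambda>k::int. \<rho> (of_int (k + 1)) / \<rho> (of_int k)))"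
  obtains K where "comparable_weight \<rho> K"
proof -
  have pos: "\<And>x. 0 < \<rho> x"
    using adm by (auto simp: admissible_weight_def)
  obtain M \<omega> where M: "1 \<le> M"
    and le: "\<And>\<tau> t. 0 < t \<Longrightarrow> \<rho> \<tau> \<le> M * exp (\<omega> * t) * \<rho> (\<tau> + t)"
    using adm by (auto simp: admissible_weight_def)
  \<comment> \<open>Each rightward leg of the detour has length at most 2;
    \<open>\<bar>\<omega>\<bar>\<close> makes the bound valid for all shorter legs.\<close>
  define C where "C = M * exp (\<bar>\<omega>\<bar> * 2)"
  have exp1: "1 \<le> exp (\<bar>\<omega>\<bar> * 2)" by simp
  have C1: "1 \<le> C"
    unfolding C_def using mult_mono[OF M exp1] M by simp
  have C: "\<rho> x \<le> C * \<rho> y" if "x \<le> y" "y \<le> x + 2" for x y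
  proof (cases "x = y")
    case True
    then show ?thesis using C1 pos[of y] by simp
  next
    case False
    then have "\<rho> x \<le> M * exp (\<omega> * (y - x)) * \<rho> y"
      using le[of "y - x" x] that by simp
    also have "\<omega> * (y - x) \<le> \<bar>\<omega>\<bar> * 2"
      using that by (intro mult_mono) auto
    then have "M * exp (\<omega> * (y - x)) * \<rho> y \<le> M * exp (\<bar>\<omega>\<bar> * 2) * \<rho> y"
      using M pos[of y] by (intro mult_right_mono mult_left_mono) auto
    finally show ?thesis by (simp add: C_def)
  qed
  obtain B0 where B0: "\<And>k::int. \<rho> (of_int (k + 1)) / \<rho> (of_int k) \<le> B0"
    using bdd by (auto simp: bdd_above_def)
  define B where "B = max 1 B0"
  have B1: "1 \<le> B" by (simp add: B_def)
  have B: "\<rho> (of_int (k + 1)) \<le> B * \<rho> (of_int k)" for k :: int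
  proof -
    have "\<rho> (of_int (k + 1)) / \<rho> (of_int k) \<le> B"
      using B0[of k] by (simp add: B_def)
    then show ?thesis using pos[of "of_int k"] by (simp add: pos_divide_le_eq)
  qed
  define K where "K = C * (B * (B * C))"
  have BC: "1 \<le> B * (B * C)"
    using B1 C1 by (metis mult_mono' mult_1 zero_le_one)
  have CK: "C \<le> K"
    unfolding K_def using mult_left_mono[OF BC, of C] C1 by simp
  have "\<rho> x \<le> K * \<rho> y" if xy: "\<bar>x - y\<bar> \<le> 1" for x y
  proof (cases "x \<le> y")
    case True
    then have "\<rho> x \<le> C * \<rho> y" using xy by (intro C) auto
    also have "\<dots> \<le> K * \<rho> y" using CK pos[of y] by (intro mult_right_mono) auto
    finally show ?thesis .
  next
    case False
    define k where "k = \<lfloor>y\<rfloor>"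
    have k: "of_int k \<le> y" "y < of_int k + 1" by (auto simp: k_def)
    have "\<rho> x \<le> C * \<rho> (of_int (k + 1 + 1))" using False xy k by (intro C) auto
    also have "\<rho> (of_int (k + 1 + 1)) \<le> B * \<rho> (of_int (k + 1))" by (rule B)
    also have "\<rho> (of_int (k + 1)) \<le> B * \<rho> (of_int k)" by (rule B)
    also have "\<rho> (of_int k) \<le> C * \<rho> y" using k by (intro C) auto
    finally show ?thesis
      using C1 B1 by (simp add: K_def mult.assoc)
  qed
  moreover have "1 \<le> K" using C1 CK by simp
  ultimately have "comparable_weight \<rho> K" using adm by unfold_locales
  then show ?thesis by (rule that)
qed

context comparable_weight
begin

lemma weight_pos: "0 < \<rho> x"
  using adm by (auto simp: admissible_weight_def)

lemma weight_nonneg: "0 \<le> \<rho> x"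
  using weight_pos less_imp_le by blast

lemma K_pos: "0 < K"
  using K_ge_1 by simp

lemma comparable: "\<bar>x - y\<bar> \<le> real n \<Longrightarrow> \<rho> x \<le> K ^ n * \<rho> y"
proof (induction n arbitrary: y)
  case (Suc n)
  \<comment> \<open>One unit step from \<open>y\<close> towards \<open>x\<close>, or
    \<open>x\<close> itself when it is that close.\<close>
  define z where "z = (if \<bar>x - y\<bar> \<le> 1 then x else if x < y then y - 1 else y + 1)"
  have z: "\<bar>x - z\<bar> \<le> real n" "\<bar>z - y\<bar> \<le> 1"
    using Suc.prems by (auto simp: z_def)
  have "\<rho> x \<le> K ^ n * \<rho> z" by (rule Suc.IH) fact
  also have "\<dots> \<le> K ^ n * (K * \<rho> y)"
    using K_ge_1 by (intro mult_left_mono unit_comparable z) auto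
  finally show ?case by (simp add: mult_ac)
qed auto

lemma C0w_decay:
  assumes "f \<in> C0w \<rho>" "0 < e"
  obtains R where "0 < R" "\<And>x. R \<le> \<bar>x\<bar> \<Longrightarrow> \<bar>f x\<bar> * \<rho> x < e"
proof -
  have "\<forall>\<^sub>F x in at_top. \<bar>f x * \<rho> x\<bar> < e" "\<forall>\<^sub>F x in at_bot. \<bar>f x * \<rho> x\<bar> < e"
    using assms tendstoD[of "\<lambda>x. f x * \<rho> x" 0 _ e] by (auto simp: C0w_def)
  then obtain b a where ab: "\<And>x. b \<le> x \<Longrightarrow> \<bar>f x * \<rho> x\<bar> < e" "\<And>x. x \<le> a \<Longrightarrow> \<bar>f x * \<rho> x\<bar> < e"
    unfolding eventually_at_top_linorder eventually_at_bot_linorder by blast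
  show thesis
  proof (rule that[of "1 + \<bar>a\<bar> + \<bar>b\<bar>"])
    show "\<bar>f x\<bar> * \<rho> x < e" if "1 + \<bar>a\<bar> + \<bar>b\<bar> \<le> \<bar>x\<bar>" for x
    proof -
      have "b \<le> x \<or> x \<le> a" using that by arith
      moreover have "\<bar>f x * \<rho> x\<bar> = \<bar>f x\<bar> * \<rho> x" by (simp add: abs_mult weight_nonneg)
      ultimately show ?thesis using ab by metis
    qed
  qed auto
qed

lemma C0wI:
  assumes "continuous_on UNIV f"
    and "\<And>e. 0 < e \<Longrightarrow> \<exists>R. \<forall>x. R \<le> \<bar>x\<bar> \<longrightarrow> \<bar>f x\<bar> * \<rho> x < e"
  shows "f \<in> C0w \<rho>"
proof -
  have "\<forall>\<^sub>F x in F. dist (f x * \<rho> x) 0 < e" if e: "0 < e" and F: "F = at_top \<or> F = at_bot" for e F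
  proof -
    obtain R where R: "\<And>x. R \<le> \<bar>x\<bar> \<Longrightarrow> \<bar>f x\<bar> * \<rho> x < e" using assms(2)[OF e] by blast
    have "\<forall>\<^sub>F x in F. R \<le> \<bar>x\<bar>"
      using F
    proof
      assume "F = at_top"
      then show ?thesis by (auto intro: eventually_mono[OF eventually_ge_at_top[of R]])
    next
      assume "F = at_bot"
      then show ?thesis by (auto intro: eventually_mono[OF eventually_le_at_bot[of "- R"]])
    qed
    then show ?thesis by eventually_elim (use R weight_nonneg in \<open>auto simp: abs_mult\<close>)
  qed
  then show ?thesis using assms(1) by (auto simp: C0w_def intro!: tendstoI)
qed

lemma C0wI_compact_support:
  assumes "continuous_on UNIV f" and "\<And>x. R \<le> \<bar>x\<bar> \<Longrightarrow> f x = 0"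
  shows "f \<in> C0w \<rho>"
  using assms by (intro C0wI exI[of _ R]) auto

lemma translation_C0w:
  assumes f: "f \<in> C0w \<rho>"
  shows "translation t f \<in> C0w \<rho>"
proof (rule C0wI)
  show "continuous_on UNIV (translation t f)"
    using f unfolding translation_def C0w_def
    by (auto intro!: continuous_on_compose2[of UNIV f] continuous_intros)
  fix e :: real assume e: "0 < e"
  define n where "n = nat \<lceil>\<bar>t\<bar>\<rceil>"
  have Kn: "0 < K ^ n" using K_pos by simp
  obtain R where R: "\<And>x. R \<le> \<bar>x\<bar> \<Longrightarrow> \<bar>f x\<bar> * \<rho> x < e / K ^ n"
    using C0w_decay[OF f, of "e / K ^ n"] e Kn by auto
  show "\<exists>R. \<forall>x. R \<le> \<bar>x\<bar> \<longrightarrow> \<bar>translation t f x\<bar> * \<rho> x < e"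
  proof (intro exI[of _ "R + \<bar>t\<bar>"] allI impI)
    fix x assume x: "R + \<bar>t\<bar> \<le> \<bar>x\<bar>"
    have "\<bar>x - (x + t)\<bar> \<le> real n"
      unfolding n_def by linarith
    then have "\<bar>f (x + t)\<bar> * \<rho> x \<le> \<bar>f (x + t)\<bar> * (K ^ n * \<rho> (x + t))"
      by (intro mult_left_mono comparable) auto
    also have "\<dots> < e"
      using R[of "x + t"] x Kn by (auto simp: field_simps)
    finally show "\<bar>translation t f x\<bar> * \<rho> x < e" by (simp add: translation_def)
  qed
qed

lemma le_C0w_dist:
  assumes "u \<in> C0w \<rho>" "v \<in> C0w \<rho>"
  shows "\<bar>u x - v x\<bar> * \<rho> x \<le> C0w_dist \<rho> u v"
  using C0w_bdd_above[OF adm C0w_diff[OF assms]] assms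
  by (auto simp: C0w_dist_def C0w_norm_def intro: cSUP_upper)

lemma C0w_dist_le:
  assumes "u \<in> C0w \<rho>" "v \<in> C0w \<rho>" "\<And>x. \<bar>u x - v x\<bar> * \<rho> x \<le> e"
  shows "C0w_dist \<rho> u v \<le> e"
  using assms by (auto simp: C0w_dist_def C0w_norm_def intro!: cSUP_least)

text \<open>On a compact interval the weight is bounded and uniform continuity suffices. Outside,
  \<open>f\<close> is small at both points, and \<open>d \<le> 1\<close> keeps their weights
  comparable.\<close>

lemma strong_continuity:
  assumes f: "f \<in> C0w \<rho>" and e: "0 < e"
  obtains d where "0 < d" "d \<le> 1" "\<And>h x. \<bar>h\<bar> \<le> d \<Longrightarrow> \<bar>f (x + h) - f x\<bar> * \<rho> x \<le> e"
proof -
  obtain R where R: "0 < R" "\<And>x. R \<le> \<bar>x\<bar> \<Longrightarrow> \<bar>f x\<bar> * \<rho> x < e / (2 * K)"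
    using C0w_decay[OF f, of "e / (2 * K)"] e K_pos by auto
  define n where "n = nat \<lceil>R + 1\<rceil>"
  have n: "R + 1 \<le> real n" unfolding n_def by linarith
  define L where "L = K ^ n * \<rho> 0"
  have L: "0 < L" unfolding L_def using K_pos weight_pos by simp
  \<comment> \<open>The radius \<open>R + 2\<close> contains \<open>x + h\<close> whenever
    \<open>\<bar>x\<bar> \<le> R + 1\<close>; for all other \<open>x\<close>, still
    \<open>R \<le> \<bar>x + h\<bar>\<close>.\<close>
  have "uniformly_continuous_on {- (R + 2)..R + 2} f"
    using f by (intro compact_uniformly_continuous) (auto simp: C0w_def intro: continuous_on_subset)
  then obtain d where d: "0 < d"
    "\<And>x y. x \<in> {- (R + 2)..R + 2} \<Longrightarrow> y \<in> {- (R + 2)..R + 2} \<Longrightarrow> dist y x < d \<Longrightarrow> dist (f y) (f x) < e / L"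
    unfolding uniformly_continuous_on_def using e L by (metis divide_pos_pos)
  show thesis
  proof (rule that[of "min 1 (d / 2)"])
    fix h x assume h: "\<bar>h\<bar> \<le> min 1 (d / 2)"
    show "\<bar>f (x + h) - f x\<bar> * \<rho> x \<le> e"
    proof (cases "\<bar>x\<bar> \<le> R + 1")
      case True
      then have "dist (f (x + h)) (f x) < e / L"
        using h d(1) by (intro d(2)) (auto simp: dist_real_def)
      moreover have "\<rho> x \<le> L"
        unfolding L_def using True n by (intro comparable) auto
      ultimately have "\<bar>f (x + h) - f x\<bar> * \<rho> x \<le> e / L * L"
        using e L weight_nonneg by (intro mult_mono) (auto simp: dist_real_def)
      then show ?thesis using L by simp
    next
      case False
      have "\<bar>f (x + h) - f x\<bar> * \<rho> x \<le> (\<bar>f (x + h)\<bar> + \<bar>f x\<bar>) * \<rho> x"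
        using weight_nonneg by (intro mult_right_mono) auto
      also have "\<dots> \<le> \<bar>f (x + h)\<bar> * (K * \<rho> (x + h)) + \<bar>f x\<bar> * (K * \<rho> x)"
        unfolding distrib_right using h by (intro add_mono mult_left_mono unit_comparable) auto
      also have "\<dots> = K * (\<bar>f (x + h)\<bar> * \<rho> (x + h)) + K * (\<bar>f x\<bar> * \<rho> x)"
        by (simp add: mult_ac)
      also have "\<dots> \<le> K * (e / (2 * K)) + K * (e / (2 * K))"
        using False h K_pos by (intro add_mono mult_left_mono less_imp_le[OF R(2)]) auto
      also have "\<dots> = e" using K_pos by simp
      finally show ?thesis .
    qed
  qed (use d in auto)
qed

end

section \<open>From a frequently hypercyclic vector to the sets \<open>E p\<close>\<close>

definition tent :: "real \<Rightarrow> real" where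
  "tent x = max 0 (1 - \<bar>x\<bar>)"

lemma tent_bounds: "0 \<le> tent x" "tent x \<le> 1"
  by (auto simp: tent_def)

lemma card_cover_measure:
  assumes "finite J" "A \<subseteq> {0..2} \<union> (\<Union>n\<in>J. {real n..real n + 2})"
  shows "measure lebesgue A \<le> 2 + 2 * real (card J)"
proof (cases "A \<in> sets lebesgue")
  case True
  let ?B = "{0..2} \<union> (\<Union>n\<in>J. {real n..real n + 2})"
  have fin: "(\<Union>n\<in>J. {real n..real n + 2}) \<in> lmeasurable"
    using assms(1) by (intro fmeasurable.finite_UN) auto
  have "measure lebesgue A \<le> measure lebesgue ?B"
    using True assms fin by (intro measure_mono_fmeasurable fmeasurable.Un) auto
  also have "\<dots> \<le> measure lebesgue {0..2::real} + measure lebesgue (\<Union>n\<in>J. {real n..real n + 2})"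
    using fin by (intro measure_Un_le) auto
  also have "\<dots> \<le> 2 + (\<Sum>n\<in>J. measure lebesgue {real n..real n + 2})"
    using assms(1) by (intro add_mono measure_UNION_le) auto
  also have "\<dots> = 2 + 2 * real (card J)" by simp
  finally show ?thesis .
\<comment> \<open>By default \<open>measure\<close> is 0 on nonmeasurable sets.\<close>
qed (simp add: measure_notin_sets)

lemma frequently_hypercyclicD:
  assumes "frequently_hypercyclic X T"
  obtains x where "x \<in> topspace X"
    "\<And>U. openin X U \<Longrightarrow> U \<noteq> {} \<Longrightarrow> 0 < lower_Dens {t. 0 \<le> t \<and> T t x \<in> U}"
  using assms by (auto simp: frequently_hypercyclic_def)

text \<open>Meant for sets \<open>A\<close> in which points at distance at most 3 are at distance below 1: then at
  most two consecutive cells \<open>{n..<n + 1}\<close> meet \<open>A\<close>, and only the first of them is kept.\<close>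

definition cluster_starts :: "real set \<Rightarrow> nat set" where
  "cluster_starts A = {n. 1 \<le> n \<and> A \<inter> {real n..<real n + 1} \<noteq> {} \<and> A \<inter> {real n - 1..<real n} = {}}"

text \<open>Up to \<open>{0..2}\<close>, the set \<open>A\<close> is covered by intervals of length
  2 at its cluster starts, so their number is at least about half the measure.\<close>

lemma lower_dens_cluster_starts:
  assumes dens: "0 < lower_Dens A"
    and clusters: "\<And>s t. s \<in> A \<Longrightarrow> t \<in> A \<Longrightarrow> \<bar>s - t\<bar> \<le> 3 \<Longrightarrow> \<bar>s - t\<bar> < 1"
  shows "0 < lower_dens (cluster_starts A)"
proof -
  obtain c where c: "c > 0" "\<forall>\<^sub>F N in sequentially. c * real N \<le> measure lebesgue (A \<inter> {0..real N})"
    using dens lower_Dens_pos_iff by blast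
  obtain N0 :: nat where N0: "2 \<le> c / 2 * real N0"
    using c(1) by (metis half_gt_zero mult.commute reals_Archimedean3 less_imp_le)
  have "\<forall>\<^sub>F N in sequentially. c / 4 * real N \<le> real (card (cluster_starts A \<inter> {1..N}))"
    using c(2) eventually_ge_at_top[of N0]
  proof eventually_elim
    case (elim N)
    have "A \<inter> {0..real N} \<subseteq> {0..2} \<union> (\<Union>n\<in>cluster_starts A \<inter> {1..N}. {real n..real n + 2})"
    proof
      fix t assume t: "t \<in> A \<inter> {0..real N}"
      define n where "n = nat \<lfloor>t\<rfloor>"
      have n: "real n \<le> t" "t < real n + 1"
        using t by (auto simp: n_def)
      then have nN: "n \<le> N" using t by auto
      show "t \<in> {0..2} \<union> (\<Union>n\<in>cluster_starts A \<inter> {1..N}. {real n..real n + 2})"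
      proof (cases "t \<le> 2")
        case False
        then have n2: "2 \<le> n" using n by linarith
        have hit: "A \<inter> {real n..<real n + 1} \<noteq> {}" using t n by auto
        show ?thesis
        proof (cases "A \<inter> {real n - 1..<real n} = {}")
          case True
          then have "n \<in> cluster_starts A \<inter> {1..N}"
            using n2 nN hit by (auto simp: cluster_starts_def)
          then show ?thesis using n by fastforce
        next
          case False
          \<comment> \<open>A point of \<open>A\<close> two cells before that of \<open>t\<close>
            would be more than 1 and less than 3 away from \<open>t\<close>. Hence the cell just
            before that of \<open>t\<close> is a start.\<close>
          have "A \<inter> {real (n - 1) - 1..<real (n - 1)} = {}"
          proof (rule ccontr)
            assume "A \<inter> {real (n - 1) - 1..<real (n - 1)} \<noteq> {}"
            then obtain s where "s \<in> A" "real (n - 1) - 1 \<le> s" "s < real (n - 1)" by auto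
            then show False using clusters[of t s] t n n2 by (auto simp: of_nat_diff)
          qed
          then have "n - 1 \<in> cluster_starts A \<inter> {1..N}"
            using n2 nN False by (auto simp: cluster_starts_def of_nat_diff)
          moreover have "t \<in> {real (n - 1)..real (n - 1) + 2}"
            using n n2 by (auto simp: of_nat_diff)
          ultimately show ?thesis by blast
        qed
      qed (use t in auto)
    qed
    then have "measure lebesgue (A \<inter> {0..real N}) \<le> 2 + 2 * real (card (cluster_starts A \<inter> {1..N}))"
      by (intro card_cover_measure) auto
    moreover have "c / 2 * real N0 \<le> c / 2 * real N"
      using c(1) elim by (intro mult_left_mono) auto
    ultimately show ?case using elim N0 by argo
  qed
  with c(1) show ?thesis
    unfolding lower_dens_pos_iff by (intro exI[of _ "c / 4"]) auto
qed

text \<open>Rewrites (b) as a separation condition: integer intervals of radii \<open>p\<close> and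
  \<open>q\<close> meet exactly when their centres are at most \<open>p + q\<close> apart.\<close>

lemma int_intervals_disjoint_iff:
  "(int ` A + {- int p..int p}) \<inter> (int ` B + {- int q..int q}) = {} \<longleftrightarrow>
     (\<forall>n\<in>A. \<forall>m\<in>B. real (p + q) < \<bar>real n - real m\<bar>)"
proof (intro iffI ballI)
  fix n m assume disj: "(int ` A + {- int p..int p}) \<inter> (int ` B + {- int q..int q}) = {}"
    and n: "n \<in> A" and m: "m \<in> B"
  show "real (p + q) < \<bar>real n - real m\<bar>"
  proof (rule ccontr)
    assume "\<not> real (p + q) < \<bar>real n - real m\<bar>"
    then have le: "\<bar>int n - int m\<bar> \<le> int p + int q" by linarith
    \<comment> \<open>\<open>int n + i\<close> is a common point: \<open>m\<close> if within reach,
      otherwise the end of the interval around \<open>n\<close> on the side of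
      \<open>m\<close>.\<close>
    define i where "i = (if \<bar>int m - int n\<bar> \<le> int p then int m - int n else if m < n then - int p else int p)"
    have "i \<in> {- int p..int p}" by (auto simp: i_def)
    then have "int n + i \<in> int ` A + {- int p..int p}" using n by (intro set_plus_intro) auto
    moreover have "int n + i - int m \<in> {- int q..int q}" using le by (auto simp: i_def)
    then have "int m + (int n + i - int m) \<in> int ` B + {- int q..int q}" using m by (intro set_plus_intro) auto
    then have "int n + i \<in> int ` B + {- int q..int q}" by simp
    ultimately show False using disj by blast
  qed
next
  assume far: "\<forall>n\<in>A. \<forall>m\<in>B. real (p + q) < \<bar>real n - real m\<bar>"
  show "(int ` A + {- int p..int p}) \<inter> (int ` B + {- int q..int q}) = {}"
  proof (rule ccontr)
    assume "(int ` A + {- int p..int p}) \<inter> (int ` B + {- int q..int q}) \<noteq> {}"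
    then obtain n i m j where *: "n \<in> A" "m \<in> B" "i \<in> {- int p..int p}" "j \<in> {- int q..int q}"
      "int n + i = int m + j"
      unfolding set_plus_def by fast
    then have "\<bar>int n - int m\<bar> \<le> int (p + q)" by auto
    then show False using far *(1,2) by force
  qed
qed

context comparable_weight
begin

text \<open>\<open>M\<close> is arbitrary, as the stronger form of the equivalence requires.\<close>

lemma fhc_imp_fhc_sets:
  assumes fhc: "frequently_hypercyclic (C0w_topology \<rho>) translation"
    and M: "pos_seq_to_infinity M"
  shows "\<exists>E. fhc_sets \<rho> M E"
proof -
  interpret Metric_space "C0w \<rho>" "C0w_dist \<rho>" by (rule Metric_space_C0w[OF adm])
  obtain f where f: "f \<in> C0w \<rho>" and
    freq: "\<And>U. openin (C0w_topology \<rho>) U \<Longrightarrow> U \<noteq> {} \<Longrightarrow> 0 < lower_Dens {t. 0 \<le> t \<and> translation t f \<in> U}"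
    using fhc by (auto elim: frequently_hypercyclicD simp: topspace_C0w[OF adm])
  have Mpos: "0 < M p" if "1 \<le> p" for p using M that by (auto simp: pos_seq_to_infinity_def)
  \<comment> \<open>Partial sums dominate each \<open>M p\<close> and grow by at least 2 per step;
    the absolute value covers the unconstrained \<open>M 0\<close>.\<close>
  define H where "H p = (\<Sum>i\<le>p. \<bar>M i\<bar> + 2)" for p
  have H_ge: "M p + 2 \<le> H p" "2 \<le> H p" for p
  proof -
    have "\<bar>M p\<bar> + 2 \<le> H p"
      unfolding H_def by (rule member_le_sum[of p "{..p}" "\<lambda>i. \<bar>M i\<bar> + 2"]) auto
    then show "M p + 2 \<le> H p" "2 \<le> H p" by auto
  qed
  have H_sep: "H p + 2 \<le> H q" if "p < q" for p q
  proof -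
    have "H q = H (q - 1) + (\<bar>M q\<bar> + 2)" using that by (cases q) (auto simp: H_def)
    moreover have "H p \<le> H (q - 1)" unfolding H_def using that by (intro sum_mono2) auto
    ultimately show ?thesis by simp
  qed
  define g where "g p x = H p * tent x" for p x
  \<comment> \<open>The first bound gives (d), with a factor \<open>K\<close> in reserve for
    rounding times. The second keeps the unweighted error below 1/2 within distance
    \<open>2 * p + 4\<close>, where the weight is at least
    \<open>\<rho> 0 / K ^ (2 * p + 4)\<close>.\<close>
  define \<epsilon> where "\<epsilon> p = min (1 / (K * M p)) (1 / 2 * (\<rho> 0 / K ^ (2 * p + 4)))" for p
  have \<epsilon>_pos: "0 < \<epsilon> p" if "1 \<le> p" for p
    using Mpos[OF that] K_pos weight_pos by (simp add: \<epsilon>_def)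
  have gC: "g p \<in> C0w \<rho>" for p
    unfolding g_def tent_def by (rule C0wI_compact_support[of _ 1]) (auto intro!: continuous_intros)
  define A where "A p = {t. 0 \<le> t \<and> translation t f \<in> mball (g p) (\<epsilon> p)}" for p
  have A_dens: "0 < lower_Dens (A p)" if "1 \<le> p" for p
    unfolding A_def using \<epsilon>_pos[OF that] gC
    by (intro freq) (auto simp: C0w_topology_def simp del: in_mball)
  have A_close: "\<bar>f s - g p (s - t)\<bar> * \<rho> (s - t) < \<epsilon> p" if "t \<in> A p" for p s t
  proof -
    have "\<bar>g p (s - t) - translation t f (s - t)\<bar> * \<rho> (s - t) \<le> C0w_dist \<rho> (g p) (translation t f)"
      by (intro le_C0w_dist gC translation_C0w f)
    also have "\<dots> < \<epsilon> p" using that by (auto simp: A_def)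
    finally show ?thesis by (simp add: translation_def abs_minus_commute)
  qed
  have A_near: "\<bar>f s - g p (s - t)\<bar> < 1 / 2" if "t \<in> A p" "\<bar>s - t\<bar> \<le> real (2 * p + 4)" for p s t
  proof -
    have "\<rho> 0 \<le> K ^ (2 * p + 4) * \<rho> (s - t)"
      using that by (intro comparable) auto
    then have "\<rho> 0 / K ^ (2 * p + 4) \<le> \<rho> (s - t)"
      using K_pos by (simp add: field_simps)
    then have "\<bar>f s - g p (s - t)\<bar> * (\<rho> 0 / K ^ (2 * p + 4)) \<le> \<bar>f s - g p (s - t)\<bar> * \<rho> (s - t)"
      by (intro mult_left_mono) auto
    also have "\<dots> < \<epsilon> p" using A_close[OF that(1)] .
    also have "\<dots> \<le> 1 / 2 * (\<rho> 0 / K ^ (2 * p + 4))" by (simp add: \<epsilon>_def)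
    finally have "\<bar>f s - g p (s - t)\<bar> * (\<rho> 0 / K ^ (2 * p + 4)) < 1 / 2 * (\<rho> 0 / K ^ (2 * p + 4))" .
    moreover have "0 < \<rho> 0 / K ^ (2 * p + 4)" using K_pos weight_pos by simp
    ultimately show ?thesis by (metis mult_less_cancel_right_pos)
  qed
  have g_le: "g p x \<le> H p" for p x
    using mult_left_mono[OF tent_bounds(2), of "H p" x] H_ge(2)[of p] by (simp add: g_def)
  have g_outside: "g p x = 0" if "1 \<le> \<bar>x\<bar>" for p x
    using that by (simp add: g_def tent_def)
  have f_peak: "\<bar>f t - H p\<bar> < 1 / 2" if "t \<in> A p" for p t
    using A_near[OF that, of t] by (simp add: g_def tent_def)
  have f_large: "M p + 1 \<le> f t" "1 \<le> f t" if "t \<in> A p" for p t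
    using f_peak[OF that] H_ge[of p] unfolding abs_less_iff by linarith+
  \<comment> \<open>At \<open>s\<close> the function \<open>f\<close> is at least 1, but at distance
    1 or more from \<open>t\<close> the tent vanishes and \<open>f\<close> would be below
    1/2.\<close>
  have near: "\<bar>s - t\<bar> < 1" if "t \<in> A p" "s \<in> A q" "\<bar>s - t\<bar> \<le> real (2 * p + 4)" for p q s t
  proof (rule ccontr)
    assume "\<not> \<bar>s - t\<bar> < 1"
    then have "\<bar>f s\<bar> < 1 / 2" using A_near[OF that(1,3)] g_outside[of "s - t" p] by simp
    with f_large(2)[OF that(2)] show False by simp
  qed
  have same_height: "H q \<le> H p + 1" if "t \<in> A p" "s \<in> A q" "\<bar>s - t\<bar> < 1" for p q s t
  proof -
    have "\<bar>s - t\<bar> \<le> real (2 * p + 4)" using that(3) by simp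
    from A_near[OF that(1) this] f_peak[OF that(2)] g_le[of p "s - t"] show ?thesis
      unfolding abs_less_iff by linarith
  qed
  \<comment> \<open>Closer times would be less than 1 apart, which forces \<open>H p\<close> and
    \<open>H q\<close> within 1. The bound exceeds \<open>p + q + 1\<close>, leaving room for the
    rounding in (b).\<close>
  have far: "real (2 * max p q + 4) < \<bar>s - t\<bar>"
    if t: "t \<in> A p" and s: "s \<in> A q" and pq: "p \<noteq> q" for p q s t
  proof (rule ccontr)
    assume *: "\<not> real (2 * max p q + 4) < \<bar>s - t\<bar>"
    have st: "\<bar>s - t\<bar> < 1"
    proof (cases "p \<le> q")
      case True
      then show ?thesis using near[OF s t] * by (simp add: abs_minus_commute max_def)
    next
      case False
      then show ?thesis using near[OF t s] * by (simp add: max_def)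
    qed
    then have "H q \<le> H p + 1" "H p \<le> H q + 1"
      using same_height[OF t s] same_height[OF s t] by (auto simp: abs_minus_commute)
    then show False using H_sep[of p q] H_sep[of q p] pq by (cases p q rule: linorder_cases) auto
  qed
  define E where "E p = cluster_starts (A p)" for p
  have E_time: "\<exists>t\<in>A p. real n \<le> t \<and> t < real n + 1" if "n \<in> E p" for n p
    using that by (auto simp: E_def cluster_starts_def)
  \<comment> \<open>For \<open>p \<noteq> q\<close> this follows from \<open>far\<close>. For
    \<open>p = q\<close> only adjacent cells could hold closer times, but the cell before a cluster
    start is empty.\<close>
  have E_sep: "1 \<le> \<bar>s - t\<bar>"
    if n: "n \<in> E p" and t: "t \<in> A p" "real n \<le> t" "t < real n + 1"
      and m: "m \<in> E q" and s: "s \<in> A q" "real m \<le> s" "s < real m + 1" and nm: "m \<noteq> n" for n m p q s t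
  proof (rule ccontr)
    assume *: "\<not> 1 \<le> \<bar>s - t\<bar>"
    have pq: "p = q" using far[OF t(1) s(1)] * by auto
    have "m = n + 1 \<or> n = m + 1" using * t s nm by linarith
    then show False
    proof
      assume "m = n + 1"
      then show False using m t pq by (auto simp: E_def cluster_starts_def)
    next
      assume "n = m + 1"
      then show False using n s pq by (auto simp: E_def cluster_starts_def)
    qed
  qed
  have "fhc_sets \<rho> M E"
    unfolding fhc_sets_def
  proof (intro conjI allI impI ballI)
    show "E p \<subseteq> {1..}" for p by (auto simp: E_def cluster_starts_def)
    show "0 < lower_dens (E p)" if "1 \<le> p" for p
      unfolding E_def by (intro lower_dens_cluster_starts A_dens that near) auto
    show "(int ` E p + {- int p..int p}) \<inter> (int ` E q + {- int q..int q}) = {}" if "p \<noteq> q" for p q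
      unfolding int_intervals_disjoint_iff
    proof (intro ballI)
      fix n m assume nm: "n \<in> E p" "m \<in> E q"
      obtain t s where ts: "t \<in> A p" "real n \<le> t" "t < real n + 1" "s \<in> A q" "real m \<le> s" "s < real m + 1"
        using E_time[OF nm(1)] E_time[OF nm(2)] by blast
      then have "\<bar>s - t\<bar> \<le> \<bar>real n - real m\<bar> + 1" by linarith
      then show "real (p + q) < \<bar>real n - real m\<bar>" using far[OF ts(1,4) that] by auto
    qed
    show "((\<lambda>n. \<rho> (real n)) \<longlongrightarrow> 0) (inf sequentially (principal (E p)))" for p
    proof (rule tendstoI)
      fix e :: real assume e: "0 < e"
      obtain R where R: "\<And>x. R \<le> \<bar>x\<bar> \<Longrightarrow> \<bar>f x\<bar> * \<rho> x < e / K"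
        using C0w_decay[OF f, of "e / K"] e K_pos by auto
      have "\<forall>\<^sub>F n in sequentially. n \<in> E p \<longrightarrow> dist (\<rho> (real n)) 0 < e"
        using eventually_ge_at_top[of "nat \<lceil>R\<rceil>"]
      proof eventually_elim
        case (elim n)
        show ?case
        proof
          assume "n \<in> E p"
          then obtain t where t: "t \<in> A p" "real n \<le> t" "t < real n + 1" using E_time by blast
          \<comment> \<open>As \<open>f\<close> is at least 1 at times in \<open>A p\<close>, the
            decay of the weighted \<open>f\<close> becomes decay of \<open>\<rho>\<close>.\<close>
          have "1 * \<rho> t \<le> \<bar>f t\<bar> * \<rho> t"
            using f_large(2)[OF t(1)] weight_nonneg by (intro mult_right_mono) auto
          also have "\<dots> < e / K" using t elim by (intro R) linarith
          finally have "K * \<rho> t < e" using K_pos by (simp add: field_simps)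
          moreover have "\<rho> (real n) \<le> K * \<rho> t" using t by (intro unit_comparable) auto
          ultimately show "dist (\<rho> (real n)) 0 < e" using weight_nonneg by simp
        qed
      qed
      then show "\<forall>\<^sub>F n in inf sequentially (principal (E p)). dist (\<rho> (real n)) 0 < e"
        by (simp add: eventually_inf_principal)
    qed
    show "\<rho> (real m - real n) \<le> 1 / (M p * M q)"
      if pq: "1 \<le> p" "1 \<le> q" and nm: "n \<in> E p" "m \<in> E q" "m \<noteq> n" for p q n m
    proof -
      obtain t s where ts: "t \<in> A p" "real n \<le> t" "t < real n + 1" "s \<in> A q" "real m \<le> s" "s < real m + 1"
        using E_time[OF nm(1)] E_time[OF nm(2)] by blast
      have "1 \<le> \<bar>s - t\<bar>" using E_sep[OF nm(1) ts(1-3) nm(2) ts(4-6) nm(3)] .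
      then have "\<bar>f s\<bar> * \<rho> (s - t) < \<epsilon> p"
        using A_close[OF ts(1), of s] g_outside[of "s - t" p] by simp
      moreover have "M q * \<rho> (s - t) \<le> \<bar>f s\<bar> * \<rho> (s - t)"
        using f_large(1)[OF ts(4)] weight_nonneg by (intro mult_right_mono) auto
      ultimately have "M q * \<rho> (s - t) \<le> 1 / (K * M p)" by (simp add: \<epsilon>_def)
      then have "K * \<rho> (s - t) \<le> 1 / (M p * M q)"
        using Mpos[OF pq(1)] Mpos[OF pq(2)] K_pos by (simp add: field_simps)
      moreover have "\<rho> (real m - real n) \<le> K * \<rho> (s - t)" using ts by (intro unit_comparable) auto
      ultimately show ?thesis by simp
    qed
  qed
  then show ?thesis by blast
qed

end

section \<open>A countable dense family of compactly supported functions\<close>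

text \<open>A Bernstein polynomial with rational coefficients, transported to \<open>{- (L + 1)..L + 1}\<close> (which
  avoids a division by zero for \<open>L = 0\<close>) and cut off outside of \<open>{- L..L}\<close>.\<close>

definition bump :: "nat \<times> rat list \<Rightarrow> real \<Rightarrow> real" where
  "bump = (\<lambda>(L, rs) x. max 0 (min 1 (real L - \<bar>x\<bar>)) *
     (\<Sum>k\<le>length rs - 1. real_of_rat (rs ! k) * Bernstein (length rs - 1) k ((x / (real L + 1) + 1) / 2)))"

lemma continuous_on_bump: "continuous_on UNIV (bump c)"
proof -
  obtain L rs where c: "c = (L, rs)" by (cases c)
  have "real L + 1 \<noteq> 0" by simp
  then show ?thesis
    unfolding c bump_def Bernstein_def prod.case by (intro continuous_intros ballI) simp_all
qed

lemma bump_outside: "real (fst c) \<le> \<bar>x\<bar> \<Longrightarrow> bump c x = 0"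
  by (cases c) (simp add: bump_def)

text \<open>Bernstein polynomials are nonnegative on \<open>{0..1}\<close> and sum to 1, so moving
  every coefficient by less than \<open>e / 2\<close> to a rational moves the sum by at most
  \<open>e / 2\<close>.\<close>

lemma bump_approx:
  assumes g: "continuous_on UNIV g" and e: "0 < e"
  obtains rs where "\<And>x. \<bar>x\<bar> \<le> real L \<Longrightarrow>
    \<bar>bump (L, rs) x - max 0 (min 1 (real L - \<bar>x\<bar>)) * g x\<bar> \<le> e"
proof -
  define G where "G z = g ((real L + 1) * (2 * z - 1))" for z
  have "continuous_on {0..1} G"
    unfolding G_def by (intro continuous_on_compose2[OF g] continuous_intros) auto
  then obtain n where n: "\<And>z. z \<in> {0..1} \<Longrightarrow> \<bar>G z - (\<Sum>k\<le>n. G (k / n) * Bernstein n k z)\<bar> < e / 2"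
    using Bernstein_Weierstrass[of G "e / 2"] e by (meson half_gt_zero order_refl)
  have "\<exists>r. \<bar>real_of_rat r - G (k / n)\<bar> < e / 2" for k :: nat
  proof -
    obtain r where "G (k / n) < real_of_rat r" "real_of_rat r < G (k / n) + e / 2"
      using of_rat_dense[of "G (k / n)" "G (k / n) + e / 2"] e by auto
    then show ?thesis by (intro exI[of _ r]) simp
  qed
  then obtain r where r: "\<bar>real_of_rat (r k) - G (k / n)\<bar> < e / 2" for k :: nat by metis
  define rs where "rs = map r [0..<Suc n]"
  show thesis
  proof (rule that[of rs])
    fix x assume x: "\<bar>x\<bar> \<le> real L"
    define z where "z = (x / (real L + 1) + 1) / 2"
    have z: "z \<in> {0..1}" "(real L + 1) * (2 * z - 1) = x"
      using x by (auto simp: z_def field_simps abs_le_iff)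
    define P where "P = (\<Sum>k\<le>n. real_of_rat (r k) * Bernstein n k z)"
    have b: "bump (L, rs) x = max 0 (min 1 (real L - \<bar>x\<bar>)) * P"
      unfolding bump_def P_def z_def rs_def by (simp add: nth_append del: upt_Suc)
    have "\<bar>P - (\<Sum>k\<le>n. G (k / n) * Bernstein n k z)\<bar>
        = \<bar>\<Sum>k\<le>n. (real_of_rat (r k) - G (k / n)) * Bernstein n k z\<bar>"
      by (simp add: P_def sum_subtractf left_diff_distrib)
    also have "\<dots> \<le> (\<Sum>k\<le>n. e / 2 * Bernstein n k z)"
    proof (rule order_trans[OF sum_abs sum_mono])
      show "\<bar>(real_of_rat (r k) - G (k / n)) * Bernstein n k z\<bar> \<le> e / 2 * Bernstein n k z" for k
        using r[of k] z e Bernstein_nonneg[of z n k] unfolding abs_mult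
        by (intro mult_mono) auto
    qed
    also have "\<dots> = e / 2" unfolding sum_distrib_left[symmetric] sum_Bernstein by simp
    finally have "\<bar>P - G z\<bar> \<le> e" using n[OF z(1)] by linarith
    then have "max 0 (min 1 (real L - \<bar>x\<bar>)) * \<bar>P - g x\<bar> \<le> 1 * e"
      using z(2) e by (intro mult_mono) (auto simp: G_def)
    then show "\<bar>bump (L, rs) x - max 0 (min 1 (real L - \<bar>x\<bar>)) * g x\<bar> \<le> e"
      by (simp add: b abs_mult flip: right_diff_distrib)
  qed
qed

text \<open>Selects the subsequence \<open>p k\<close>; strictness makes (b) applicable to different
  \<open>k\<close>.\<close>

lemma ex_strict_mono_choice:
  fixes P :: "nat \<Rightarrow> nat \<Rightarrow> bool"
  assumes "\<And>k. \<forall>\<^sub>F n in sequentially. P k n"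
  obtains p where "strict_mono p" "\<And>k. P k (p k)"
proof -
  have ex: "\<exists>n>m. P k n" for k m
    using eventually_conj[OF assms[of k] eventually_gt_at_top[of m]]
    by (auto simp: eventually_sequentially)
  have "\<exists>p. \<forall>k. P k (p k) \<and> p k < p (Suc k)"
    by (rule dependent_nat_choice) (use ex in blast)+
  then show ?thesis using that by (auto simp: strict_mono_Suc_iff)
qed

context comparable_weight
begin

lemma bump_C0w: "bump c \<in> C0w \<rho>"
  by (rule C0wI_compact_support[OF continuous_on_bump bump_outside])

text \<open>Cutting \<open>f\<close> off changes it only where its weighted value is small; the
  result is then approximated uniformly on \<open>\<bar>x\<bar> \<le> real L\<close>, where the
  weight is at most \<open>D\<close>. The codes \<open>c\<close> form a countable type.\<close>

lemma bump_dense: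
  assumes f: "f \<in> C0w \<rho>" and e: "0 < e"
  obtains c where "C0w_dist \<rho> (bump c) f \<le> e"
proof -
  obtain R where R: "0 < R" "\<And>x. R \<le> \<bar>x\<bar> \<Longrightarrow> \<bar>f x\<bar> * \<rho> x < e / 2"
    using C0w_decay[OF f, of "e / 2"] e by auto
  define L where "L = nat \<lceil>R\<rceil> + 1"
  have L: "R \<le> real L - 1" unfolding L_def using R(1) by auto
  define D where "D = K ^ L * \<rho> 0"
  have D: "0 < D" unfolding D_def using K_pos weight_pos by simp
  define \<phi> where "\<phi> x = max 0 (min 1 (real L - \<bar>x\<bar>))" for x
  obtain rs where rs: "\<And>x. \<bar>x\<bar> \<le> real L \<Longrightarrow> \<bar>bump (L, rs) x - \<phi> x * f x\<bar> \<le> e / (2 * D)"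
    unfolding \<phi>_def using bump_approx[of f "e / (2 * D)" L] f e D by (auto simp: C0w_def)
  have "\<bar>bump (L, rs) x - f x\<bar> * \<rho> x \<le> e" for x
  proof -
    have "\<bar>bump (L, rs) x - \<phi> x * f x\<bar> * \<rho> x \<le> e / 2"
    proof (cases "\<bar>x\<bar> \<le> real L")
      case True
      have "\<rho> x \<le> D" unfolding D_def using True by (intro comparable) auto
      then have "\<bar>bump (L, rs) x - \<phi> x * f x\<bar> * \<rho> x \<le> e / (2 * D) * D"
        using rs[OF True] e D weight_nonneg by (intro mult_mono) auto
      then show ?thesis using D by simp
    next
      case False
      then show ?thesis using e bump_outside[of "(L, rs)" x] by (simp add: \<phi>_def)
    qed
    moreover have "\<bar>\<phi> x * f x - f x\<bar> * \<rho> x \<le> e / 2"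
    proof (cases "R \<le> \<bar>x\<bar>")
      case True
      have "\<bar>\<phi> x * f x - f x\<bar> = \<bar>\<phi> x - 1\<bar> * \<bar>f x\<bar>"
        by (simp add: left_diff_distrib flip: abs_mult)
      also have "\<dots> \<le> 1 * \<bar>f x\<bar>" by (intro mult_right_mono) (auto simp: \<phi>_def)
      finally have "\<bar>\<phi> x * f x - f x\<bar> * \<rho> x \<le> \<bar>f x\<bar> * \<rho> x"
        using weight_nonneg by (intro mult_right_mono) auto
      then show ?thesis using R(2)[OF True] by simp
    next
      case False
      then have "\<phi> x = 1" using L by (simp add: \<phi>_def)
      then show ?thesis using e by simp
    qed
    moreover have "\<bar>bump (L, rs) x - f x\<bar> * \<rho> x \<le> (\<bar>bump (L, rs) x - \<phi> x * f x\<bar> + \<bar>\<phi> x * f x - f x\<bar>) * \<rho> x"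
      using weight_nonneg by (intro mult_right_mono) auto
    ultimately show ?thesis unfolding distrib_right by linarith
  qed
  then show thesis
    using that[of "(L, rs)"] by (auto intro!: C0w_dist_le bump_C0w f)
qed

section \<open>Gluing translated copies into one function\<close>

text \<open>The \<open>G k\<close> may repeat, so that each function of a dense family can be listed
  with every accuracy.\<close>

lemma fhc_sets_imp_orbit_approx:
  fixes G :: "nat \<Rightarrow> real \<Rightarrow> real" and L :: "nat \<Rightarrow> nat" and acc :: "nat \<Rightarrow> real"
  assumes M: "pos_seq_to_infinity M" and E: "fhc_sets \<rho> M E"
    and cont: "\<And>k. continuous_on UNIV (G k)"
    and supp: "\<And>k x. real (L k) \<le> \<bar>x\<bar> \<Longrightarrow> G k x = 0"
    and acc: "\<And>k. 0 < acc k"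
  obtains f F where "f \<in> C0w \<rho>" "\<And>k. 0 < lower_dens (F k)"
    "\<And>k n. n \<in> F k \<Longrightarrow> C0w_dist \<rho> (translation (real n) f) (G k) \<le> acc k"
proof -
  have "\<exists>b>0. \<forall>x. \<bar>G k x\<bar> \<le> b" for k
  proof -
    have "compact (G k ` {- real (L k)..real (L k)})"
      by (intro compact_continuous_image continuous_on_subset[OF cont]) auto
    then obtain b where b: "0 < b" "\<And>x. x \<in> {- real (L k)..real (L k)} \<Longrightarrow> \<bar>G k x\<bar> \<le> b"
      by (force dest: compact_imp_bounded simp: bounded_pos)
    have "\<bar>G k x\<bar> \<le> b" for x
      using b(1) b(2)[of x] supp[of k x] by (cases "\<bar>x\<bar> \<le> real (L k)") (auto simp: abs_le_iff)
    with b(1) show ?thesis by blast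
  qed
  then obtain b where b: "\<And>k. 0 < b k" "\<And>k x. \<bar>G k x\<bar> \<le> b k" by metis
  text \<open>The four requirements make, in this order, all \<open>M (p k)\<close> at least 1, the error at times in
    \<open>F k\<close> at most \<open>acc k\<close>, the factor \<open>M (p q)\<close> in (d) absorb the size of \<open>G q\<close>, and two copies of
    the same \<open>G k\<close> disjoint.\<close>
  define big where "big k = max 1 (max (1 / acc k) (max (b k * K ^ L k) (K ^ (2 * L k) / \<rho> 0 + 1)))" for k
  have "\<forall>\<^sub>F n in sequentially. 1 \<le> n \<and> L k \<le> n \<and> big k \<le> M n" for k
    using M by (intro eventually_conj eventually_ge_at_top)
      (auto simp: pos_seq_to_infinity_def filterlim_at_top)
  then obtain p where p: "strict_mono p" "\<And>k. 1 \<le> p k \<and> L k \<le> p k \<and> big k \<le> M (p k)"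
    using ex_strict_mono_choice[of "\<lambda>k n. 1 \<le> n \<and> L k \<le> n \<and> big k \<le> M n"] by blast
  have Mp: "1 \<le> M (p k)" "1 / acc k \<le> M (p k)" "b k * K ^ L k \<le> M (p k)"
    "K ^ (2 * L k) / \<rho> 0 < M (p k)" for k
    using p(2)[of k] by (auto simp: big_def)
  have p1: "1 \<le> p k" and Lp: "L k \<le> p k" for k using p(2) by auto
  have E_tail: "\<exists>n0. \<forall>n\<in>E (p k). n0 \<le> n \<longrightarrow> b k * K ^ L k * \<rho> (real n) < e" if e: "0 < e" for k e
  proof -
    have bK: "0 < b k * K ^ L k" using b(1) K_pos by simp
    have "((\<lambda>n. \<rho> (real n)) \<longlongrightarrow> 0) (inf sequentially (principal (E (p k))))"
      using E p1 by (auto simp: fhc_sets_def)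
    then have "\<forall>\<^sub>F n in inf sequentially (principal (E (p k))). \<rho> (real n) < e / (b k * K ^ L k)"
      using bK e by (intro order_tendstoD(2)) auto
    then show ?thesis
      unfolding eventually_inf_principal eventually_sequentially pos_less_divide_eq[OF bK]
      by (metis mult.commute)
  qed
  have "\<exists>n0. \<forall>n\<in>E (p k). n0 \<le> n \<longrightarrow> b k * K ^ L k * \<rho> (real n) < 1 / (real k + 1)" for k
    by (rule E_tail) simp
  then obtain n0 where n0: "\<And>k n. n \<in> E (p k) \<Longrightarrow> n0 k \<le> n \<Longrightarrow> b k * K ^ L k * \<rho> (real n) < 1 / (real k + 1)"
    by metis
  \<comment> \<open>\<open>n0 k\<close> makes copies with large \<open>k\<close> uniformly small.
    The bound \<open>2 * L k + k\<close> keeps the copy at \<open>n\<close> to the right of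
    \<open>n / 2\<close> and its index at most \<open>n\<close>, so that bounded intervals meet
    finitely many copies.\<close>
  define F where "F k = E (p k) \<inter> {max (n0 k) (2 * L k + k)..}" for k
  have F_dens: "0 < lower_dens (F k)" for k
    unfolding F_def using E p1 by (intro lower_dens_pos_tail) (auto simp: fhc_sets_def)
  have F_ge: "k \<le> n" "2 * L k \<le> n" if "n \<in> F k" for k n using that by (auto simp: F_def)
  have F_small: "b k * K ^ L k * \<rho> (real n) < 1 / (real k + 1)" if "n \<in> F k" for k n
    using that n0 by (auto simp: F_def)
  have F_gap: "\<rho> (real m - real n) \<le> 1 / (M (p k) * M (p q))" if "n \<in> F k" "m \<in> F q" "m \<noteq> n" for k q n m
    using E p1 that by (auto simp: fhc_sets_def F_def)
  \<comment> \<open>Copies of functions with different indices are separated by (b), as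
    \<open>L k \<le> p k\<close>. Copies with the same index are separated by (d): within distance
    \<open>2 * L k\<close> of 0 the weight is at least \<open>\<rho> 0 / K ^ (2 * L k)\<close>,
    which exceeds \<open>1 / M (p k)\<close>.\<close>
  have disj: "real (L k + L q) < \<bar>real n - real m\<bar>"
    if n: "n \<in> F k" and m: "m \<in> F q" and ne: "(k, n) \<noteq> (q, m)" for k n q m
  proof (cases "k = q")
    case True
    show ?thesis
    proof (rule ccontr)
      assume "\<not> real (L k + L q) < \<bar>real n - real m\<bar>"
      then have "\<rho> 0 \<le> K ^ (2 * L k) * \<rho> (real m - real n)"
        using True by (intro comparable) auto
      also have "\<rho> (real m - real n) \<le> 1 / (M (p k) * M (p k))"
        using F_gap[OF n m] ne True by auto
      also have "\<dots> \<le> 1 / (M (p k) * 1)"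
        using Mp(1)[of k] by (intro divide_left_mono mult_left_mono) auto
      finally have "\<rho> 0 \<le> K ^ (2 * L k) * (1 / M (p k))"
        using K_pos by simp
      then show False using Mp(1,4)[of k] weight_pos[of 0] by (simp add: field_simps)
    qed
  next
    case False
    then have pkq: "p k \<noteq> p q" using p(1) by (simp add: strict_mono_eq)
    have "real (p k + p q) < \<bar>real n - real m\<bar>"
      using E p1 pkq n m by (simp add: fhc_sets_def int_intervals_disjoint_iff F_def)
    then show ?thesis using Lp[of k] Lp[of q] by simp
  qed

  text \<open>Distinct summands of \<open>f\<close> have disjoint supports by \<open>disj\<close>, so at every point at most
    one of them is nonzero and \<open>f\<close> needs no infinite series.\<close>
  define I where "I = (SIGMA k:UNIV. F k)"
  define h where "h c x = G (fst c) (x - real (snd c))" for c x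
  define f where "f x = (\<Sum>c\<in>{c \<in> I. h c x \<noteq> 0}. h c x)" for x
  have h_nonzero: "\<bar>x - real (snd c)\<bar> < real (L (fst c))" if "h c x \<noteq> 0" for c x
    using supp[of "fst c" "x - real (snd c)"] that unfolding h_def by (meson not_less)
  have h_unique: "c = c'" if "c \<in> I" "c' \<in> I" "\<bar>x - real (snd c)\<bar> < real (L (fst c))"
    "\<bar>x - real (snd c')\<bar> < real (L (fst c'))" for c c' x
    using disj[of "snd c" "fst c" "snd c'" "fst c'"] that unfolding I_def by (cases c; cases c') force
  have f_on: "f x = h c x" if "c \<in> I" "\<bar>x - real (snd c)\<bar> < real (L (fst c))" for c x
  proof (cases "h c x = 0")
    case True
    then have "{c \<in> I. h c x \<noteq> 0} = {}" using h_unique[OF _ that(1) _ that(2)] h_nonzero by blast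
    then have "f x = 0" unfolding f_def by (simp only: sum.empty)
    with True show ?thesis by simp
  next
    case False
    then have "{c \<in> I. h c x \<noteq> 0} = {c}" using h_unique[OF _ that(1) _ that(2)] h_nonzero that by blast
    then have "f x = sum (\<lambda>c. h c x) {c}" unfolding f_def by (simp only:)
    then show ?thesis by simp
  qed
  have f_cases: "f x = 0 \<or> (\<exists>c\<in>I. \<bar>x - real (snd c)\<bar> < real (L (fst c)) \<and> f x = h c x)" for x
  proof (cases "{c \<in> I. h c x \<noteq> 0} = {}")
    case True
    then show ?thesis unfolding f_def by (metis sum.empty)
  next
    case False
    then obtain c where "c \<in> I" "h c x \<noteq> 0" by auto
    then show ?thesis using f_on h_nonzero by blast
  qed

  have f_cont: "continuous_on UNIV f"
  proof -
    have "isCont f x" for x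
    proof -
      \<comment> \<open>A copy at \<open>n\<close> lives beyond \<open>n / 2\<close>, so it reaches
        \<open>ball x 1\<close> only if \<open>n < 2 * (\<bar>x\<bar> + 1)\<close>.\<close>
      define J where "J = {c \<in> I. real (snd c) < 2 * (\<bar>x\<bar> + 1)}"
      define r where "r = nat \<lceil>2 * (\<bar>x\<bar> + 1)\<rceil>"
      have r: "2 * (\<bar>x\<bar> + 1) \<le> real r" unfolding r_def by linarith
      have "J \<subseteq> {..r} \<times> {..r}"
      proof
        fix c assume "c \<in> J"
        then have "fst c \<le> snd c" "real (snd c) < 2 * (\<bar>x\<bar> + 1)"
          using F_ge by (auto simp: J_def I_def)
        then have "fst c \<le> r" "snd c \<le> r" using r by linarith+
        then show "c \<in> {..r} \<times> {..r}" by (simp add: mem_Times_iff)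
      qed
      then have J: "finite J" by (rule finite_subset) auto
      have eq: "f y = (\<Sum>c\<in>J. h c y)" if "y \<in> ball x 1" for y
        unfolding f_def
      proof (rule sum.mono_neutral_left[OF J])
        show "{c \<in> I. h c y \<noteq> 0} \<subseteq> J"
        proof
          fix c assume c: "c \<in> {c \<in> I. h c y \<noteq> 0}"
          then have "real (snd c) - real (L (fst c)) < y" using h_nonzero[of c y] by auto
          moreover have "2 * real (L (fst c)) \<le> real (snd c)"
            using F_ge(2)[of "snd c" "fst c"] c by (auto simp: I_def)
          moreover have "y < \<bar>x\<bar> + 1" using that by (auto simp: dist_real_def)
          ultimately show "c \<in> J" using c by (auto simp: J_def)
        qed
      qed (auto simp: J_def)
      have "continuous_on (ball x 1) (\<lambda>y. \<Sum>c\<in>J. h c y)"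
        unfolding h_def by (intro continuous_intros continuous_on_compose2[OF cont]) auto
      then have "continuous_on (ball x 1) f"
        by (rule continuous_on_eq) (simp add: eq)
      then show ?thesis by (simp add: continuous_on_eq_continuous_at)
    qed
    then show ?thesis by (simp add: continuous_on_eq_continuous_at)
  qed

  \<comment> \<open>The value is taken at \<open>x\<close> and the weight at \<open>y\<close>: for
    translates of \<open>f\<close> these points differ.\<close>
  have h_bound: "\<bar>h (q, m) x\<bar> * \<rho> y \<le> b q * K ^ L q * \<rho> z" if "\<bar>y - z\<bar> \<le> real (L q)" for q m x y z
  proof -
    have "\<bar>h (q, m) x\<bar> * \<rho> y \<le> b q * (K ^ L q * \<rho> z)"
      using b weight_nonneg that by (intro mult_mono comparable) (auto simp: h_def less_imp_le)
    then show ?thesis by (simp add: mult.assoc)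
  qed

  have fC: "f \<in> C0w \<rho>"
  proof (rule C0wI[OF f_cont])
    fix e :: real assume e: "0 < e"
    obtain k0 :: nat where k0: "1 / (real k0 + 1) < e"
      using e nat_approx_posE by (metis Suc_eq_plus1 of_nat_Suc add.commute)
    obtain N where N: "\<And>k n. n \<in> F k \<Longrightarrow> N k \<le> n \<Longrightarrow> b k * K ^ L k * \<rho> (real n) < e"
      using E_tail[OF e] unfolding F_def by (metis IntD1)
    \<comment> \<open>Copies with index at least \<open>k0\<close> are small by
      \<open>F_small\<close>; those with smaller index are small at positions beyond
      \<open>N1\<close>. A copy reaching a point with \<open>\<bar>x\<bar> \<ge> 2 * real N1\<close>
      sits at some \<open>m \<ge> N1\<close>.\<close>
    define N1 where "N1 = (\<Sum>k<k0. N k)"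
    show "\<exists>R. \<forall>x. R \<le> \<bar>x\<bar> \<longrightarrow> \<bar>f x\<bar> * \<rho> x < e"
    proof (intro exI[of _ "2 * real N1"] allI impI)
      fix x assume x: "2 * real N1 \<le> \<bar>x\<bar>"
      consider "f x = 0" | q m where "m \<in> F q" "\<bar>x - real m\<bar> < real (L q)" "f x = h (q, m) x"
        using f_cases[of x] by (auto simp: I_def)
      then show "\<bar>f x\<bar> * \<rho> x < e"
      proof cases
        case 1
        then show ?thesis using e by simp
      next
        case 2
        have le: "\<bar>f x\<bar> * \<rho> x \<le> b q * K ^ L q * \<rho> (real m)"
          unfolding 2(3) using 2(2) by (intro h_bound) auto
        show ?thesis
        proof (cases "q < k0")
          case True
          have "N q \<le> N1" unfolding N1_def using True by (intro member_le_sum) auto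
          moreover have "N1 \<le> m" using x 2(2) F_ge(2)[OF 2(1)] by linarith
          ultimately show ?thesis using N[OF 2(1)] le by simp
        next
          case False
          then have "1 / (real q + 1) \<le> 1 / (real k0 + 1)" by (intro divide_left_mono) auto
          then show ?thesis using F_small[OF 2(1)] le k0 by simp
        qed
      qed
    qed
  qed

  have approx: "C0w_dist \<rho> (translation (real n) f) (G k) \<le> acc k" if n: "n \<in> F k" for k n
  proof (rule C0w_dist_le)
    show "translation (real n) f \<in> C0w \<rho>" by (rule translation_C0w[OF fC])
    show "G k \<in> C0w \<rho>" by (rule C0wI_compact_support[OF cont supp])
    fix y
    have kn: "(k, n) \<in> I" using n by (simp add: I_def)
    show "\<bar>translation (real n) f y - G k y\<bar> * \<rho> y \<le> acc k"
    proof (cases "\<bar>y\<bar> < real (L k)")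
      case True
      then have "f (y + real n) = G k y" using f_on[OF kn, of "y + real n"] by (simp add: h_def)
      then show ?thesis using acc[of k] by (simp add: translation_def)
    next
      case False
      then have Gy: "G k y = 0" by (intro supp) simp
      consider "f (y + real n) = 0"
        | q m where "m \<in> F q" "\<bar>y + real n - real m\<bar> < real (L q)" "f (y + real n) = h (q, m) (y + real n)"
        using f_cases[of "y + real n"] by (auto simp: I_def)
      then show ?thesis
      proof cases
        case 1
        then show ?thesis using acc[of k] Gy by (simp add: translation_def)
      next
        case 2
        have "(k, n) \<noteq> (q, m)" using 2(2) False by auto
        then have mn: "m \<noteq> n" using disj[OF n 2(1)] by fastforce
        have "\<bar>translation (real n) f y - G k y\<bar> * \<rho> y = \<bar>h (q, m) (y + real n)\<bar> * \<rho> y"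
          using Gy 2(3) by (simp add: translation_def)
        also have "\<dots> \<le> b q * K ^ L q * \<rho> (real m - real n)"
          using 2(2) by (intro h_bound) auto
        \<comment> \<open>One factor \<open>M (p q)\<close> absorbs the size of \<open>G q\<close>;
          (d) leaves \<open>1 / M (p k)\<close>.\<close>
        also have "\<dots> \<le> M (p q) * (1 / (M (p k) * M (p q)))"
          using Mp[of q] weight_nonneg by (intro mult_mono F_gap n 2(1) mn) auto
        also have "\<dots> = 1 / M (p k)" using Mp(1)[of q] by simp
        also have "\<dots> \<le> acc k" using Mp(1,2)[of k] acc[of k] by (simp add: field_simps)
        finally show ?thesis .
      qed
    qed
  qed
  show thesis
    using that[of f F] fC F_dens approx by blast
qed

end

section \<open>From integer times to continuous times\<close>

lemma lower_Dens_pos_of_intervals: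
  assumes dens: "0 < lower_dens F" and d: "0 < d" "d \<le> 1"
    and S: "S \<in> sets lebesgue" and sub: "\<And>n. n \<in> F \<Longrightarrow> {real n..<real n + d} \<subseteq> S"
  shows "0 < lower_Dens S"
proof -
  obtain c where c: "c > 0" "\<forall>\<^sub>F N in sequentially. c * real N \<le> real (card (F \<inter> {1..N}))"
    using dens lower_dens_pos_iff by blast
  obtain N0 :: nat where N0: "1 \<le> c / 2 * real N0"
    using c(1) by (metis half_gt_zero mult.commute reals_Archimedean3 less_imp_le)
  have "\<forall>\<^sub>F N in sequentially. d * c / 2 * real N \<le> measure lebesgue (S \<inter> {0..real N})"
    using c(2) eventually_ge_at_top[of N0]
  proof eventually_elim
    case (elim N)
    \<comment> \<open>\<open>N\<close> is left out because its interval runs past \<open>N\<close>;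
      this costs at most 1 in the count.\<close>
    let ?J = "F \<inter> {1..<N}" and ?I = "\<lambda>n. {real n..<real n + d}"
    have "F \<inter> {1..N} \<subseteq> insert N ?J" by auto
    then have "card (F \<inter> {1..N}) \<le> card (insert N ?J)" by (intro card_mono) auto
    also have "\<dots> \<le> Suc (card ?J)" by (rule card_insert_le_m1) auto
    finally have "real (card (F \<inter> {1..N})) - 1 \<le> real (card ?J)" by simp
    moreover have "c / 2 * real N0 \<le> c / 2 * real N"
      using c(1) elim by (intro mult_left_mono) auto
    ultimately have "c / 2 * real N \<le> real (card ?J)" using elim N0 by argo
    then have "d * c / 2 * real N \<le> d * real (card ?J)"
      using d mult_left_mono[of "c / 2 * real N" "real (card ?J)" d] by simp
    also have "\<dots> = (\<Sum>n\<in>?J. measure lebesgue (?I n))" using d by simp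
    also have "\<dots> = measure lebesgue (\<Union>n\<in>?J. ?I n)"
    proof (rule measure_finite_Union[symmetric])
      show "disjoint_family_on ?I ?J"
        unfolding disjoint_family_on_def
      proof (intro ballI impI)
        fix m n :: nat assume "m \<noteq> n"
        then have "m + 1 \<le> n \<or> n + 1 \<le> m" by linarith
        then have "real m + 1 \<le> real n \<or> real n + 1 \<le> real m" by linarith
        then show "?I m \<inter> ?I n = {}" using d by auto
      qed
    qed (use d in auto)
    also have "\<dots> \<le> measure lebesgue (S \<inter> {0..real N})"
    proof (rule measure_mono_fmeasurable)
      have "?I n \<subseteq> {0..real N}" if "n \<in> ?J" for n
      proof -
        have "real n + 1 \<le> real N" using that by auto
        then show ?thesis using d by auto
      qed
      then show "(\<Union>n\<in>?J. ?I n) \<subseteq> S \<inter> {0..real N}" using sub by blast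
      show "S \<inter> {0..real N} \<in> lmeasurable"
        using fmeasurable_Int_fmeasurable[OF lmeasurable_interval(1) S, of 0 "real N"] by (simp add: Int_commute)
    qed auto
    finally show ?case .
  qed
  moreover have "0 < d * c / 2" using c(1) d by simp
  ultimately show ?thesis unfolding lower_Dens_pos_iff by blast
qed

context comparable_weight
begin

text \<open>Orbit maps are continuous by strong continuity. This serves the measurability of the
  sets of return times.\<close>

lemma open_translation_vimage:
  assumes f: "f \<in> C0w \<rho>" and U: "openin (C0w_topology \<rho>) U"
  shows "open {t. translation t f \<in> U}"
proof -
  interpret Metric_space "C0w \<rho>" "C0w_dist \<rho>" by (rule Metric_space_C0w[OF adm])
  show ?thesis
    unfolding open_dist
  proof
    fix t assume "t \<in> {t. translation t f \<in> U}"
    then have t: "translation t f \<in> U" by simp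
    then obtain r where r: "0 < r" "mball (translation t f) r \<subseteq> U"
      using U unfolding C0w_topology_def openin_mtopology by blast
    obtain d where d: "0 < d" "\<And>h x. \<bar>h\<bar> \<le> d \<Longrightarrow> \<bar>translation t f (x + h) - translation t f x\<bar> * \<rho> x \<le> r / 2"
      using strong_continuity[OF translation_C0w[OF f] half_gt_zero[OF r(1)]] by metis
    show "\<exists>e>0. \<forall>s. dist s t < e \<longrightarrow> s \<in> {t. translation t f \<in> U}"
    proof (intro exI[of _ d] conjI allI impI)
      fix s assume s: "dist s t < d"
      have "C0w_dist \<rho> (translation t f) (translation s f) \<le> r / 2"
        using d(2)[of "s - t"] s
        by (intro C0w_dist_le translation_C0w f)
          (auto simp: translation_def dist_real_def algebra_simps abs_minus_commute)
      then have "translation s f \<in> mball (translation t f) r"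
        using r(1) translation_C0w[OF f] by simp
      then show "s \<in> {t. translation t f \<in> U}" using r(2) by blast
    qed (rule d)
  qed
qed

lemma fhc_sets_imp_fhc:
  assumes M: "pos_seq_to_infinity M" and E: "fhc_sets \<rho> M E"
  shows "frequently_hypercyclic (C0w_topology \<rho>) translation"
proof -
  interpret Metric_space "C0w \<rho>" "C0w_dist \<rho>" by (rule Metric_space_C0w[OF adm])
  \<comment> \<open>Enumerates all pairs of a bump and an accuracy.\<close>
  define code :: "nat \<Rightarrow> (nat \<times> rat list) \<times> nat" where "code = from_nat"
  obtain f F where f: "f \<in> C0w \<rho>" and F: "\<And>k. 0 < lower_dens (F k)"
    "\<And>k n. n \<in> F k \<Longrightarrow> C0w_dist \<rho> (translation (real n) f) (bump (fst (code k))) \<le> 1 / (real (snd (code k)) + 1)"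
    using fhc_sets_imp_orbit_approx[OF M E, of "\<lambda>k. bump (fst (code k))" "\<lambda>k. fst (fst (code k))"
        "\<lambda>k. 1 / (real (snd (code k)) + 1)"] continuous_on_bump bump_outside
    by (metis add_nonneg_pos divide_pos_pos of_nat_0_le_iff zero_less_one)
  show ?thesis
    unfolding frequently_hypercyclic_def
  proof (intro bexI[of _ f] allI impI)
    show "f \<in> topspace (C0w_topology \<rho>)" using f by (simp add: topspace_C0w[OF adm])
    fix U assume "openin (C0w_topology \<rho>) U \<and> U \<noteq> {}"
    then have U: "openin (C0w_topology \<rho>) U" "U \<noteq> {}" by auto
    then obtain g r where g: "g \<in> U" "g \<in> C0w \<rho>" and r: "0 < r" "mball g r \<subseteq> U"
      unfolding C0w_topology_def openin_mtopology by blast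
    \<comment> \<open>Two approximations of size \<open>e\<close>, times \<open>K\<close> for moving
      the weight, cost \<open>r / 4\<close>; the continuity of \<open>g\<close> costs another
      \<open>r / 4\<close>.\<close>
    define e where "e = r / (8 * K)"
    have e: "0 < e" "K * (2 * e) = r / 4" using r(1) K_pos by (auto simp: e_def)
    obtain c where c: "C0w_dist \<rho> (bump c) g \<le> e" using bump_dense[OF g(2) e(1)] .
    obtain j :: nat where j: "1 / (real j + 1) < e"
      using nat_approx_posE[OF e(1)] by (metis Suc_eq_plus1 of_nat_Suc add.commute)
    obtain d where d: "0 < d" "d \<le> 1" "\<And>h x. \<bar>h\<bar> \<le> d \<Longrightarrow> \<bar>g (x + h) - g x\<bar> * \<rho> x \<le> r / 4"
      using strong_continuity[OF g(2), of "r / 4"] r(1) by (metis zero_less_divide_iff zero_less_numeral)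
    define k where "k = to_nat (c, j)"
    have k: "code k = (c, j)" by (simp add: code_def k_def)
    let ?S = "{t. 0 \<le> t \<and> translation t f \<in> U}"
    have "{real n..<real n + d} \<subseteq> ?S" if n: "n \<in> F k" for n
    proof
      fix t assume t: "t \<in> {real n..<real n + d}"
      have near: "C0w_dist \<rho> (translation (real n) f) g \<le> 2 * e"
        using triangle[OF translation_C0w[OF f] bump_C0w g(2), of "real n" c] F(2)[OF n] c j k by simp
      have "C0w_dist \<rho> g (translation t f) \<le> r / 2"
      proof (rule C0w_dist_le[OF g(2) translation_C0w[OF f]])
        fix x
        \<comment> \<open>\<open>f (x + t)\<close> is compared with \<open>g (x + s)\<close>, which
          moves the weight from \<open>x + s\<close> to \<open>x\<close>, and then
          \<open>g (x + s)\<close> with \<open>g x\<close>.\<close>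
        define s where "s = t - real n"
        have s: "\<bar>s\<bar> \<le> d" "t = s + real n" using t by (auto simp: s_def)
        have "\<bar>f (x + s + real n) - g (x + s)\<bar> * \<rho> (x + s) \<le> 2 * e"
          using le_C0w_dist[OF translation_C0w[OF f, of "real n"] g(2), of "x + s"] near
          by (simp add: translation_def)
        then have "K * (\<bar>f (x + s + real n) - g (x + s)\<bar> * \<rho> (x + s)) \<le> K * (2 * e)"
          using K_pos by (intro mult_left_mono) auto
        then have 1: "\<bar>f (x + s + real n) - g (x + s)\<bar> * (K * \<rho> (x + s)) \<le> r / 4"
          unfolding e(2) by (simp only: mult_ac)
        have "\<bar>f (x + s + real n) - g (x + s)\<bar> * \<rho> x \<le> \<bar>f (x + s + real n) - g (x + s)\<bar> * (K * \<rho> (x + s))"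
          using s d(2) by (intro mult_left_mono unit_comparable) auto
        with 1 have 2: "\<bar>f (x + s + real n) - g (x + s)\<bar> * \<rho> x \<le> r / 4" by (rule order_trans[rotated])
        have "\<bar>g x - f (x + s + real n)\<bar> * \<rho> x
            \<le> (\<bar>f (x + s + real n) - g (x + s)\<bar> + \<bar>g (x + s) - g x\<bar>) * \<rho> x"
          using weight_nonneg by (intro mult_right_mono) auto
        then have "\<bar>g x - f (x + s + real n)\<bar> * \<rho> x \<le> r / 2"
          using 2 d(3)[OF s(1), of x] unfolding distrib_right by linarith
        then show "\<bar>g x - translation t f x\<bar> * \<rho> x \<le> r / 2"
          by (simp add: translation_def s(2) add.assoc)
      qed
      then have "translation t f \<in> mball g r" using r(1) g(2) translation_C0w[OF f] by simp
      then show "t \<in> ?S" using r(2) t by auto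
    qed
    moreover have "?S = {0..} \<inter> {t. translation t f \<in> U}" by auto
    then have "?S \<in> sets lebesgue" using open_translation_vimage[OF f U(1)] by auto
    ultimately show "0 < lower_Dens ?S"
      using d F(1) by (intro lower_Dens_pos_of_intervals[of "F k" d])
  qed
qed

end

theorem theorem3p2:
  fixes \<rho> :: "real \<Rightarrow> real"
  assumes "admissible_weight \<rho>"
    and "bdd_above (range (\<lambda>k::int. \<rho> (of_int (k + 1)) / \<rho> (of_int k)))"
  shows "(frequently_hypercyclic (C0w_topology \<rho>) translation \<longleftrightarrow>
            (\<exists>M E. pos_seq_to_infinity M \<and> fhc_sets \<rho> M E)) \<and>
         (frequently_hypercyclic (C0w_topology \<rho>) translation \<longleftrightarrow>
            (\<forall>M. pos_seq_to_infinity M \<longrightarrow> (\<exists>E. fhc_sets \<rho> M E)))"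
proof -
  obtain K where "comparable_weight \<rho> K"
    using admissible_imp_comparable_weight[OF assms] .
  then interpret comparable_weight \<rho> K .
  \<comment> \<open>Some admissible \<open>M\<close> must exist for the form with all
    \<open>M\<close> to imply the form with one.\<close>
  have "pos_seq_to_infinity real"
    by (simp add: pos_seq_to_infinity_def filterlim_real_sequentially)
  then show ?thesis using fhc_imp_fhc_sets fhc_sets_imp_fhc by blast
qed

end
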